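(* Let $x,y\in X$ with $T^nx\ne y$ for all $n\ge1$, and suppose $$w:=\liminf_{r\to0}\frac{\log\tau_{B(y,r)}(x)}{-\log r}<\infty.$$ Let $(r_n)_{n\in\mathbb{N}}$ be a nonincreasing sequence of (positive) radii with $$\limsup_{n\to\infty}\frac{-\log r_n}{\log n}<\frac1w.$$ Then $x\in\limsup_n T^{-n}B(y,r_n)$, i.e. $T^nx\in B(y,r_n)$ for infinitely many $n$.
   Context: Standing assumptions: $(X,d)$ is a metric space, $\mu$ is a Borel probability measure on $X$, and $T:X\to X$ is measurable and preserves $\mu$, i.e. $\mu(T^{-1}A)=\mu(A)$ for all Borel $A$. $\mathbb{N}=\{1,2,\dots\}$. $B(y,r)=\{z\in X: d(z,y)\le r\}$ is the closed ball of center $y$ and radius $r>0$. For $A\subset X$ measurable, the waiting time is $\tau_A(x)=\min\{n\in\mathbb{N}:T^nx\in A\}\in\mathbb{N}\cup\{\infty\}$ (with $\log\infty=\infty$). $\limsup_n T^{-n}A_n=\{x: T^nx\in A_n\text{ for infinitely many }n\}$. If $w=0$, then $1/w$ is read as $\infty$. *)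

theory Defs
  imports "HOL-Probability.Probability"
begin

text \<open>The infimum is over positive \<open>n\<close>; it is a minimum if some such \<open>n\<close> exists,
  and \<open>\<infinity>\<close> (infimum of the empty set) otherwise.\<close>

definition waiting_time :: "('a \<Rightarrow> 'a) \<Rightarrow> 'a set \<Rightarrow> 'a \<Rightarrow> enat" where
  "waiting_time T A x = (INF n\<in>{n. 1 \<le> n \<and> (T ^^ n) x \<in> A}. enat n)"

text \<open>Only applied to \<open>n \<ge> 1\<close>.\<close>

definition ln_enat :: "enat \<Rightarrow> ereal" where
  "ln_enat n = (case n of enat k \<Rightarrow> ereal (ln (real k)) | \<infinity> \<Rightarrow> \<infinity>)"

definition lower_waiting_exponent ::
    "('a::metric_space \<Rightarrow> 'a) \<Rightarrow> 'a \<Rightarrow> 'a \<Rightarrow> ereal" where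
  "lower_waiting_exponent T x y =
     Liminf (at_right (0::real)) (\<lambda>r. ln_enat (waiting_time T (cball y r) x) / ereal (- ln r))"

definition limsup_preimages :: "('a \<Rightarrow> 'a) \<Rightarrow> (nat \<Rightarrow> 'a set) \<Rightarrow> 'a set" where
  "limsup_preimages T A = {x. infinite {n. 1 \<le> n \<and> (T ^^ n) x \<in> A n}}"

definition measure_preserving_map :: "'a measure \<Rightarrow> ('a \<Rightarrow> 'a) \<Rightarrow> bool" where
  "measure_preserving_map M T \<longleftrightarrow>
     T \<in> measurable M M \<and> (\<forall>A\<in>sets M. emeasure M (T -` A \<inter> space M) = emeasure M A)"

text \<open>The lower waiting exponent is nonnegative, and division by zero in \<^typ>\<open>ereal\<close> satisfies
  the convention \<open>1 / 0 = \<infinity>\<close>.\<close>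

lemma one_divide_zero_ereal: "1 / (0::ereal) = \<infinity>"
  by (simp add: divide_ereal_def)

end

(* If the limsup is below a and a is below 1/w, then eventually r n exceeds n powr (-a), while for
   arbitrarily small \<rho> the first entrance time m into the ball of radius \<rho> around y satisfies
   \<rho> < m powr (-a).  The orbit avoids y, so m grows beyond all bounds as \<rho> tends to 0; hence
   \<rho> < r m and the point reached at time m lies in the ball of radius r m. *)

theory Submission
  imports Defs
begin

lemma waiting_time_ge_1: "1 \<le> waiting_time T A x"
  unfolding waiting_time_def by (intro INF_greatest) (auto simp: one_enat_def)

text \<open>The infimum over the empty set is \<open>\<infinity>\<close>, so a finite value forces a
  nonempty set of hitting times, and by well-ordering its infimum is attained.\<close>

lemma waiting_time_eq_enatD:
  assumes "waiting_time T A x = enat m"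
  shows "1 \<le> m" "(T ^^ m) x \<in> A"
proof -
  let ?S = "{n. 1 \<le> n \<and> (T ^^ n) x \<in> A}"
  have "?S \<noteq> {}"
  proof
    assume "?S = {}"
    then have "waiting_time T A x = \<infinity>"
      unfolding waiting_time_def by (simp only: image_empty Inf_empty top_enat_def)
    with assms show False by simp
  qed
  then have "Inf (enat ` ?S) \<in> enat ` ?S"
    by (metis (lifting) all_not_in_conv imageI wellorder_InfI)
  then have "enat m \<in> enat ` ?S"
    using assms unfolding waiting_time_def by (simp only:)
  then have "m \<in> ?S"
    by blast
  then show "1 \<le> m" "(T ^^ m) x \<in> A" by auto
qed

lemma ln_enat_nonneg: "1 \<le> n \<Longrightarrow> 0 \<le> ln_enat n"
  by (cases n) (auto simp: ln_enat_def one_enat_def)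

text \<open>For radii in (0,1) the denominator \<open>- ln \<rho>\<close> is positive, and waiting
  times are at least 1. This sign is what later allows passing between \<open>w\<close> and
  \<open>1 / w\<close>.\<close>

lemma lower_waiting_exponent_nonneg: "0 \<le> lower_waiting_exponent T x y"
  unfolding lower_waiting_exponent_def
proof (rule Liminf_bounded)
  have "\<forall>\<^sub>F \<rho> in at_right (0::real). \<rho> \<in> {0<..<1}"
    by (rule eventually_at_right_real) simp
  then show "\<forall>\<^sub>F \<rho> in at_right (0::real).
      0 \<le> ln_enat (waiting_time T (cball y \<rho>) x) / ereal (- ln \<rho>)"
    by eventually_elim
      (intro zero_le_divide_ereal ln_enat_nonneg waiting_time_ge_1, auto)
qed

text \<open>A liminf below \<open>c\<close> forces the quotient below \<open>c\<close> for
  arbitrarily small radii; for radii below 1 the positive denominator can be cleared.\<close>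

lemma frequently_early_entrance:
  assumes "lower_waiting_exponent T x y < ereal c"
  shows "\<exists>\<^sub>F \<rho> in at_right 0. \<exists>m\<ge>1. (T ^^ m) x \<in> cball y \<rho> \<and> ln (real m) < c * - ln \<rho>"
proof -
  let ?f = "\<lambda>\<rho>. ln_enat (waiting_time T (cball y \<rho>) x) / ereal (- ln \<rho>)"
  have "\<exists>\<^sub>F \<rho> in at_right 0. ?f \<rho> < ereal c"
    using assms Liminf_bounded[of "ereal c" ?f "at_right 0"]
    unfolding lower_waiting_exponent_def frequently_def by (auto simp: not_less)
  moreover have "\<forall>\<^sub>F \<rho> in at_right (0::real). \<rho> \<in> {0<..<1}"
    by (rule eventually_at_right_real) simp
  ultimately have "\<exists>\<^sub>F \<rho> in at_right 0. ?f \<rho> < ereal c \<and> \<rho> \<in> {0<..<1}"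
    by (rule frequently_eventually_frequently)
  then show ?thesis
  proof (rule frequently_elim1)
    fix \<rho> :: real
    assume \<rho>: "?f \<rho> < ereal c \<and> \<rho> \<in> {0<..<1}"
    then have "0 < \<rho>" "\<rho> < 1" by auto
    then have pos: "0 < - ln \<rho>" by simp
    have infinity_divide: "\<infinity> / ereal l = \<infinity>" if "0 < l" for l
      using that by (simp add: divide_ereal_def)
    \<comment> \<open>An infinite waiting time would make the quotient \<open>\<infinity>\<close>,
      which is not below \<open>c\<close>.\<close>
    obtain m where m: "waiting_time T (cball y \<rho>) x = enat m"
    proof (cases "waiting_time T (cball y \<rho>) x")
      case infinity
      then have "?f \<rho> = \<infinity>"
        using infinity_divide[OF pos] by (simp add: ln_enat_def)
      with \<rho> show thesis by simp
    qed
    have "ln (real m) / - ln \<rho> < c"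
      using conjunct1[OF \<rho>] pos by (simp add: m ln_enat_def)
    then have "ln (real m) < c * - ln \<rho>"
      using pos by (simp only: pos_divide_less_eq)
    then show "\<exists>m\<ge>1. (T ^^ m) x \<in> cball y \<rho> \<and> ln (real m) < c * - ln \<rho>"
      using waiting_time_eq_enatD[OF m] by blast
  qed
qed

theorem theorem6p2:
  fixes \<mu> :: "'a::metric_space measure"
    and T :: "'a \<Rightarrow> 'a"
    and x y :: 'a
    and r :: "nat \<Rightarrow> real"
    and w :: ereal
  assumes "prob_space \<mu>"
    and "sets \<mu> = sets borel"
    and "measure_preserving_map \<mu> T"
    and "\<And>n. n \<ge> 1 \<Longrightarrow> (T ^^ n) x \<noteq> y"
    and "w = lower_waiting_exponent T x y"
    and "w < \<infinity>"
    and "\<And>n. n \<ge> 1 \<Longrightarrow> r n > 0"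
    and "antimono_on {1..} r"
    and "limsup (\<lambda>n. ereal (- ln (r n) / ln (real n))) < 1 / w"
  shows "x \<in> limsup_preimages T (\<lambda>n. cball y (r n))"
proof -
  have "0 \<le> w"
    using assms(5) lower_waiting_exponent_nonneg by simp
  then have "0 < 1 / w"
    using \<open>w < \<infinity>\<close> by (cases w; cases "w = 0") (simp_all add: one_divide_zero_ereal, simp add: one_ereal_def)
  \<comment> \<open>The maximum with 0 makes the intermediate real \<open>a\<close> positive, so
    that \<open>a < 1 / w\<close> can be inverted.\<close>
  then have "max 0 (limsup (\<lambda>n. ereal (- ln (r n) / ln (real n)))) < 1 / w"
    using assms(9) by (simp only: max_less_iff_conj)
  then obtain a where a_lower: "max 0 (limsup (\<lambda>n. ereal (- ln (r n) / ln (real n)))) < ereal a"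
    and a_upper: "ereal a < 1 / w"
    by (blast dest: ereal_dense2)
  have "0 < a" using a_lower by simp
  have w_less: "w < ereal (1 / a)"
  \<comment> \<open>The value 0 is treated apart: there \<open>1 / w\<close> is
    \<open>\<infinity>\<close>, and the claim is just \<open>0 < 1 / a\<close>.\<close>
  proof (cases w)
    case (real v)
    with \<open>0 \<le> w\<close> \<open>0 < a\<close> a_upper show ?thesis
      by (cases "v = 0") (auto simp: one_ereal_def field_simps)
  qed (use assms(6) \<open>0 \<le> w\<close> in auto)
  have "\<forall>\<^sub>F n in sequentially. ereal (- ln (r n) / ln (real n)) < ereal a"
    using a_lower by (intro Limsup_lessD) simp
  then obtain N0 where N0: "\<And>n. n \<ge> N0 \<Longrightarrow> - ln (r n) / ln (real n) < a"
    by (auto simp: eventually_sequentially)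
  have "\<exists>m>N. 1 \<le> m \<and> (T ^^ m) x \<in> cball y (r m)" for N
  proof -
    \<comment> \<open>A time beyond \<open>K\<close> exceeds \<open>N\<close>, lies in the range
      where \<open>N0\<close> applies, and has a positive logarithm.\<close>
    define K where "K = max N (max N0 2)"
    \<comment> \<open>Each of these finitely many orbit points has positive distance from
      \<open>y\<close>; smaller radii miss them all.\<close>
    have "\<forall>\<^sub>F \<rho> in at_right 0. \<forall>n\<in>{1..K}. (T ^^ n) x \<notin> cball y \<rho>"
    proof (rule eventually_ball_finite, simp, rule ballI)
      fix n assume "n \<in> {1..K}"
      then have "0 < dist y ((T ^^ n) x)" using assms(4)[of n] by auto
      then have "\<forall>\<^sub>F \<rho> in at_right 0. \<rho> \<in> {0<..<dist y ((T ^^ n) x)}"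
        by (rule eventually_at_right_real)
      then show "\<forall>\<^sub>F \<rho> in at_right 0. (T ^^ n) x \<notin> cball y \<rho>"
        by eventually_elim simp
    qed
    moreover have "\<forall>\<^sub>F \<rho> in at_right (0::real). 0 < \<rho>"
      by (rule eventually_at_right_less)
    ultimately have "\<forall>\<^sub>F \<rho> in at_right 0. 0 < \<rho> \<and> (\<forall>n\<in>{1..K}. (T ^^ n) x \<notin> cball y \<rho>)"
      by eventually_elim simp
    with frequently_early_entrance[OF w_less[unfolded assms(5)]]
    have "\<exists>\<^sub>F \<rho> in at_right 0.
        (\<exists>m\<ge>1. (T ^^ m) x \<in> cball y \<rho> \<and> ln (real m) < 1 / a * - ln \<rho>) \<and>
        0 < \<rho> \<and> (\<forall>n\<in>{1..K}. (T ^^ n) x \<notin> cball y \<rho>)"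
      by (rule frequently_eventually_frequently)
    then obtain \<rho> m where "0 < \<rho>" "1 \<le> m" and m_cball: "(T ^^ m) x \<in> cball y \<rho>"
      and m_ln: "ln (real m) < 1 / a * - ln \<rho>"
      and avoid: "\<forall>n\<in>{1..K}. (T ^^ n) x \<notin> cball y \<rho>"
      by (blast dest: frequently_ex)
    have "K < m"
      using avoid m_cball \<open>1 \<le> m\<close> by (meson atLeastAtMost_iff not_le)
    then have "N < m" "N0 \<le> m" "2 \<le> m" by (auto simp: K_def)
    have "ln \<rho> < - a * ln (real m)"
      using m_ln \<open>0 < a\<close> by (simp add: field_simps)
    \<comment> \<open>The bound from \<open>N0\<close> is multiplied by \<open>ln (real m)\<close>,
      positive since \<open>m\<close> is at least 2.\<close>
    also have "\<dots> < ln (r m)"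
      using N0[OF \<open>N0 \<le> m\<close>] \<open>2 \<le> m\<close> by (simp add: field_simps)
    finally have "\<rho> < r m"
      using \<open>0 < \<rho>\<close> assms(7)[OF \<open>1 \<le> m\<close>] by simp
    then show ?thesis
      using \<open>N < m\<close> \<open>1 \<le> m\<close> m_cball by auto
  qed
  then show ?thesis
    by (auto simp: limsup_preimages_def infinite_nat_iff_unbounded)
qed

end
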